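(* Let $G$ be any countable group and assume that there exists a multiorder $(\tilde{\mathcal O},\nu,G)$ on $G$. Then the multiorder $(\tilde{\mathcal O},\nu,G)$ has the Følner property, i.e. for $\nu$-almost every $\prec\,\in\tilde{\mathcal O}$ the order intervals $[e,b_n]^{\prec}$ (where $b_n$ denotes the $n$th successor of the unit $e$ in the order $\prec$) form a Følner sequence in $G$. In particular, $G$ is amenable.
   Context: Here $G$ is an infinite countable (discrete) group with unit $e$. A linear order $\prec$ on $G$ is of type $\mathbb Z$ if every order interval $[a,b]^{\prec}=\{a,b\}\cup\{g\in G: a\prec g\prec b\}$ ($a\prec b$) is finite and $G$ has no minimal or maximal element. The set $\tilde{\mathcal O}$ of all orders of type $\mathbb Z$ on $G$ is a Borel subset of $\{0,1\}^{G\times G}$ (relations identified with their indicator functions, product topology), with the inherited Borel sigma-algebra. $G$ acts on $\tilde{\mathcal O}$ by: $\prec'=g(\prec)$ where $a\prec' b\iff ag\prec bg$. A multiorder on $G$ is the measure-preserving action $(\tilde{\mathcal O},\nu,G)$, where $\nu$ is a $G$-invariant Borel probability measure on $\tilde{\mathcal O}$. A Følner sequence in $G$ is a sequence of finite subsets $F_n\subset G$ such that $\lim_n |F_n\cap gF_n|/|F_n|=1$ for every $g\in G$; $G$ is amenable if it has a Følner sequence. *)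

theory Defs
  imports "HOL-Probability.Probability" "HOL-Algebra.Coset"
begin

text \<open>
  A binary relation on the group is represented by its indicator function, a point of
  \<open>{0,1}\<close> to the power \<open>G \<times> G\<close>. The point is an extensional function on
  \<open>carrier G \<times> carrier G\<close>, with \<open>bool\<close> in place of \<open>{0,1}\<close>.
\<close>

definition relation_topology :: "('a, 'm) monoid_scheme \<Rightarrow> ('a \<times> 'a \<Rightarrow> bool) topology" where
  "relation_topology G =
     product_topology (\<lambda>_. discrete_topology UNIV) (carrier G \<times> carrier G)"

definition relation_borel :: "('a, 'm) monoid_scheme \<Rightarrow> ('a \<times> 'a \<Rightarrow> bool) measure" where
  "relation_borel G =
     sigma (topspace (relation_topology G)) {U. openin (relation_topology G) U}"

definition rel_of :: "('a, 'm) monoid_scheme \<Rightarrow> ('a \<times> 'a \<Rightarrow> bool) \<Rightarrow> 'a rel" where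
  "rel_of G x = {p \<in> carrier G \<times> carrier G. x p}"

definition order_interval :: "'a rel \<Rightarrow> 'a \<Rightarrow> 'a \<Rightarrow> 'a set" where
  "order_interval r a b = {a, b} \<union> {g. (a, g) \<in> r \<and> (g, b) \<in> r}"

definition type_Z_order_on :: "'a set \<Rightarrow> 'a rel \<Rightarrow> bool" where
  "type_Z_order_on A r \<longleftrightarrow>
     r \<subseteq> A \<times> A \<and> strict_linear_order_on A r \<and>
     (\<forall>a b. (a, b) \<in> r \<longrightarrow> finite (order_interval r a b)) \<and>
     \<not> (\<exists>m\<in>A. \<forall>a\<in>A. (a, m) \<notin> r) \<and>
     \<not> (\<exists>m\<in>A. \<forall>a\<in>A. (m, a) \<notin> r)"

definition Z_orders :: "('a, 'm) monoid_scheme \<Rightarrow> ('a \<times> 'a \<Rightarrow> bool) set" where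
  "Z_orders G =
     {x \<in> topspace (relation_topology G). type_Z_order_on (carrier G) (rel_of G x)}"

definition order_action ::
  "('a, 'm) monoid_scheme \<Rightarrow> 'a \<Rightarrow> ('a \<times> 'a \<Rightarrow> bool) \<Rightarrow> ('a \<times> 'a \<Rightarrow> bool)" where
  "order_action G g x =
     (\<lambda>p \<in> carrier G \<times> carrier G. x (fst p \<otimes>\<^bsub>G\<^esub> g, snd p \<otimes>\<^bsub>G\<^esub> g))"

text \<open>
  The invariance condition makes sense because \<open>order_action G g\<close> is measurable,
  see \<open>order_action_measurable\<close> below.
\<close>

definition multiorder ::
  "('a, 'm) monoid_scheme \<Rightarrow> ('a \<times> 'a \<Rightarrow> bool) measure \<Rightarrow> bool" where
  "multiorder G \<nu> \<longleftrightarrow>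
     prob_space \<nu> \<and>
     sets \<nu> = sets (restrict_space (relation_borel G) (Z_orders G)) \<and>
     (\<forall>g\<in>carrier G. distr \<nu> \<nu> (order_action G g) = \<nu>)"

definition order_succ :: "'a rel \<Rightarrow> 'a \<Rightarrow> 'a" where
  "order_succ r a = (THE b. (a, b) \<in> r \<and> \<not> (\<exists>c. (a, c) \<in> r \<and> (c, b) \<in> r))"

text \<open>
  Since \<open>0 / 0 = 0\<close>, the limit condition forces the sets to be eventually nonempty.
\<close>

definition Folner_sequence :: "('a, 'm) monoid_scheme \<Rightarrow> (nat \<Rightarrow> 'a set) \<Rightarrow> bool" where
  "Folner_sequence G F \<longleftrightarrow>
     (\<forall>n. finite (F n) \<and> F n \<subseteq> carrier G) \<and>
     (\<forall>g\<in>carrier G.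
        (\<lambda>n. real (card (F n \<inter> (g <#\<^bsub>G\<^esub> F n))) / real (card (F n))) \<longlonglongrightarrow> 1)"

definition amenable :: "('a, 'm) monoid_scheme \<Rightarrow> bool" where
  "amenable G \<longleftrightarrow> (\<exists>F. Folner_sequence G F)"

definition Folner_property ::
  "('a, 'm) monoid_scheme \<Rightarrow> ('a \<times> 'a \<Rightarrow> bool) measure \<Rightarrow> bool" where
  "Folner_property G \<nu> \<longleftrightarrow>
     (AE x in \<nu>. Folner_sequence G
        (\<lambda>n. order_interval (rel_of G x) \<one>\<^bsub>G\<^esub> ((order_succ (rel_of G x) ^^ n) \<one>\<^bsub>G\<^esub>)))"

lemma topspace_relation_topology:
  "topspace (relation_topology G) = (\<Pi>\<^sub>E p\<in>carrier G \<times> carrier G. UNIV)"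
  by (simp add: relation_topology_def)

lemma rel_of_order_action:
  assumes "group G" "g \<in> carrier G"
  shows "(a, b) \<in> rel_of G (order_action G g x) \<longleftrightarrow>
    a \<in> carrier G \<and> b \<in> carrier G \<and> (a \<otimes>\<^bsub>G\<^esub> g, b \<otimes>\<^bsub>G\<^esub> g) \<in> rel_of G x"
proof -
  interpret group G by fact
  show ?thesis using assms(2) by (auto simp: rel_of_def order_action_def)
qed

lemma order_action_Z_orders:
  assumes G: "group G" and g: "g \<in> carrier G" and x: "x \<in> Z_orders G"
  shows "order_action G g x \<in> Z_orders G"
proof -
  interpret group G by fact
  let ?r = "rel_of G x" and ?s = "rel_of G (order_action G g x)"
  note s = rel_of_order_action[OF G g]
  have r: "type_Z_order_on (carrier G) ?r" using x by (simp add: Z_orders_def)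
  have sub: "?s \<subseteq> carrier G \<times> carrier G" by (auto simp: rel_of_def)
  have tr: "trans ?s"
    using r by (auto simp: type_Z_order_on_def strict_linear_order_on_def s intro!: transI dest: transD)
  have ir: "irrefl ?s"
    using r by (auto simp: type_Z_order_on_def strict_linear_order_on_def s irrefl_def)
  have tot: "total_on (carrier G) ?s"
    using r g by (auto simp: type_Z_order_on_def strict_linear_order_on_def s total_on_def)
  have shift: "\<exists>a\<in>carrier G. c = a \<otimes>\<^bsub>G\<^esub> g" if "c \<in> carrier G" for c
    using that g by (intro bexI[of _ "c \<otimes>\<^bsub>G\<^esub> inv\<^bsub>G\<^esub> g"]) (auto simp: m_assoc)
  have fin: "finite (order_interval ?s a b)" if ab: "(a, b) \<in> ?s" for a b
  proof -
    have "finite (order_interval ?r (a \<otimes>\<^bsub>G\<^esub> g) (b \<otimes>\<^bsub>G\<^esub> g))"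
      using r ab by (auto simp: type_Z_order_on_def s)
    moreover have "(\<lambda>h. h \<otimes>\<^bsub>G\<^esub> g) ` order_interval ?s a b \<subseteq>
        order_interval ?r (a \<otimes>\<^bsub>G\<^esub> g) (b \<otimes>\<^bsub>G\<^esub> g)"
      by (auto simp: order_interval_def s)
    moreover have "inj_on (\<lambda>h. h \<otimes>\<^bsub>G\<^esub> g) (order_interval ?s a b)"
      using ab g by (intro inj_onI) (auto simp: order_interval_def s)
    ultimately show ?thesis by (meson finite_imageD finite_subset)
  qed
  have lo: "\<exists>a\<in>carrier G. (a, m) \<in> ?s" if m: "m \<in> carrier G" for m
  proof -
    have "m \<otimes>\<^bsub>G\<^esub> g \<in> carrier G" using m g by simp
    then obtain c where "c \<in> carrier G" "(c, m \<otimes>\<^bsub>G\<^esub> g) \<in> ?r"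
      using r unfolding type_Z_order_on_def by blast
    then show ?thesis using shift m by (metis s)
  qed
  have hi: "\<exists>a\<in>carrier G. (m, a) \<in> ?s" if m: "m \<in> carrier G" for m
  proof -
    have "m \<otimes>\<^bsub>G\<^esub> g \<in> carrier G" using m g by simp
    then obtain c where "c \<in> carrier G" "(m \<otimes>\<^bsub>G\<^esub> g, c) \<in> ?r"
      using r unfolding type_Z_order_on_def by blast
    then show ?thesis using shift m by (metis s)
  qed
  have "type_Z_order_on (carrier G) ?s"
    unfolding type_Z_order_on_def strict_linear_order_on_def
    using sub tr ir tot fin lo hi by blast
  then show ?thesis
    by (simp add: Z_orders_def topspace_relation_topology) (simp add: order_action_def)
qed

lemma order_action_measurable:
  assumes G: "group G" and g: "g \<in> carrier G"
    and \<nu>: "sets \<nu> = sets (restrict_space (relation_borel G) (Z_orders G))"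
  shows "order_action G g \<in> \<nu> \<rightarrow>\<^sub>M \<nu>"
proof -
  interpret group G by fact
  let ?T = "relation_topology G"
  have cont: "continuous_map ?T ?T (order_action G g)"
    unfolding relation_topology_def
  proof (subst continuous_map_componentwise, intro conjI ballI)
    fix p assume p: "p \<in> carrier G \<times> carrier G"
    have "continuous_map (product_topology (\<lambda>_. discrete_topology UNIV) (carrier G \<times> carrier G))
        (discrete_topology (UNIV :: bool set))
        (\<lambda>x. x (fst p \<otimes>\<^bsub>G\<^esub> g, snd p \<otimes>\<^bsub>G\<^esub> g))"
      using p g by (intro continuous_map_product_projection) auto
    then show "continuous_map
        (product_topology (\<lambda>_. discrete_topology UNIV) (carrier G \<times> carrier G))
        (discrete_topology (UNIV :: bool set)) (\<lambda>x. order_action G g x p)"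
      using p by (simp add: order_action_def)
  qed (auto simp: order_action_def)
  have "order_action G g \<in> relation_borel G \<rightarrow>\<^sub>M relation_borel G"
    unfolding relation_borel_def
  proof (rule measurable_measure_of)
    fix U assume "U \<in> {U. openin ?T U}"
    then have "openin ?T {x \<in> topspace ?T. order_action G g x \<in> U}"
      using cont by (simp add: continuous_map_def)
    moreover have "{x \<in> topspace ?T. order_action G g x \<in> U} = order_action G g -` U \<inter> topspace ?T"
      by auto
    ultimately show "order_action G g -` U \<inter> space (sigma (topspace ?T) {U. openin ?T U})
        \<in> sets (sigma (topspace ?T) {U. openin ?T U})"
      by (auto simp: space_measure_of_conv sets_measure_of_conv dest: openin_subset)
  qed (use cont in \<open>auto simp: space_measure_of_conv continuous_map_def dest: openin_subset\<close>)
  then have "order_action G g \<in> restrict_space (relation_borel G) (Z_orders G) \<rightarrow>\<^sub>M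
      restrict_space (relation_borel G) (Z_orders G)"
    using order_action_Z_orders[OF G g]
    by (intro measurable_restrict_space2 measurable_restrict_space1)
      (auto simp: space_restrict_space)
  then show ?thesis using measurable_cong_sets[OF \<nu> \<nu>] by simp
qed

end

theory Submission
  imports Defs
begin

text \<open>
  Let \<open>S\<close> send an order to its image under the successor of the unit; it preserves \<open>\<nu>\<close>, and
  \<open>S ^^ i\<close> is the action of the \<open>i\<close>-th successor \<open>a i\<close> of the unit. The distance from \<open>a i\<close> to
  \<open>g \<otimes> a i\<close> in the order \<open>x\<close> equals the distance from the unit to \<open>g\<close> in the order \<open>(S ^^ i) x\<close>.
  Hence, if \<open>i \<le> n\<close> and \<open>g \<otimes> a i\<close> is outside the interval \<open>{a 0, \<dots>, a n}\<close>, then \<open>i\<close> is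
  within \<open>k\<close> of \<open>0\<close> or of \<open>n\<close>, or \<open>(S ^^ i) x\<close> lies in the set of orders in which \<open>g\<close> is
  \<open>k\<close>-far from the unit. These sets decrease to the empty set as \<open>k\<close> grows, so the maximal ergodic
  inequality bounds, almost surely and for suitable \<open>k\<close>, the frequency of visits to them by any
  prescribed positive number.
\<close>

section \<open>The maximal ergodic inequality\<close>

text \<open>This is the maximum of the Birkhoff sums of length \<open>n \<le> N\<close>, the empty
  sum included. The recursion exposes the relation between \<open>x\<close> and \<open>T x\<close>
  on which Garsia's argument rests.\<close>

fun max_sum :: "('b \<Rightarrow> real) \<Rightarrow> ('b \<Rightarrow> 'b) \<Rightarrow> nat \<Rightarrow> 'b \<Rightarrow> real" where
  "max_sum f T 0 x = 0"
| "max_sum f T (Suc N) x = max 0 (f x + max_sum f T N (T x))"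

lemma max_sum_nonneg: "0 \<le> max_sum f T N x"
  by (cases N) auto

lemma max_sum_mono_Suc: "max_sum f T N x \<le> max_sum f T (Suc N) x"
proof (induction N arbitrary: x)
  case (Suc N)
  then have "f x + max_sum f T N (T x) \<le> f x + max_sum f T (Suc N) (T x)" by simp
  then show ?case
    unfolding max_sum.simps(2)[of f T "Suc N" x] max_sum.simps(2)[of f T N x]
    by (intro max.mono order_refl)
qed simp

lemma sum_orbit_le_max_sum: "(\<Sum>i<n. f ((T ^^ i) x)) \<le> max_sum f T n x"
proof (induction n arbitrary: x)
  case (Suc n)
  have "(\<Sum>i<Suc n. f ((T ^^ i) x)) = f x + (\<Sum>i<n. f ((T ^^ i) (T x)))"
    by (simp add: sum.lessThan_Suc_shift funpow_swap1 del: sum.lessThan_Suc)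
  with Suc[of "T x"] show ?case by simp
qed simp

text \<open>A positive maximum comes from the second argument of \<open>max\<close>. Monotonicity
  raises the index there back to \<open>N\<close>, so that one function stands on both sides and
  invariance can cancel its integrals.\<close>

lemma max_sum_le:
  assumes "max_sum f T N x > 0"
  shows "max_sum f T N x \<le> f x + max_sum f T N (T x)"
proof (cases N)
  case (Suc n)
  with assms max_sum_mono_Suc[of f T n "T x"] show ?thesis by (simp add: max_def split: if_splits)
qed (use assms in simp)

lemma max_sum_measurable:
  assumes [measurable]: "f \<in> borel_measurable M" "T \<in> M \<rightarrow>\<^sub>M M"
  shows "max_sum f T N \<in> borel_measurable M"
proof (induction N)
  case 0
  have "max_sum f T 0 = (\<lambda>_. 0)" by auto
  then show ?case by simp
next
  case (Suc N)
  note [measurable] = Suc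
  have "max_sum f T (Suc N) = (\<lambda>x. max 0 (f x + max_sum f T N (T x)))" by auto
  then show ?case by simp
qed

lemma max_sum_le_bound:
  assumes "\<And>x. f x \<le> C" "0 \<le> C"
  shows "max_sum f T N x \<le> real N * C"
proof (induction N arbitrary: x)
  case (Suc N)
  have "f x + max_sum f T N (T x) \<le> C + real N * C"
    using assms(1)[of x] Suc[of "T x"] by linarith
  with assms(2) show ?case by (simp add: algebra_simps)
qed simp

text \<open>Garsia's argument.\<close>

lemma (in prob_space) maximal_inequality_max_sum:
  assumes T [measurable]: "T \<in> M \<rightarrow>\<^sub>M M" and inv: "distr M M T = M"
    and B [measurable]: "B \<in> sets M" and l: "0 < l"
  shows "l * prob {x \<in> space M. max_sum (\<lambda>x. indicator B x - l) T N x > 0} \<le> prob B"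
proof -
  define f :: "'a \<Rightarrow> real" where "f x = indicator B x - l" for x
  have [measurable]: "f \<in> borel_measurable M" unfolding f_def by measurable
  note [measurable] = max_sum_measurable[of f M T N]
  define P where "P = {x \<in> space M. max_sum f T N x > 0}"
  have P [measurable]: "P \<in> sets M" unfolding P_def by measurable
  have bound: "max_sum f T N x \<le> real N" for x
    using max_sum_le_bound[of f 1 T N x] l by (auto simp: f_def indicator_def)
  have iF: "integrable M (max_sum f T N)"
    using bound max_sum_nonneg[of f T N] by (intro integrable_const_bound[where B = "real N"]) auto
  have iFT: "integrable M (\<lambda>x. max_sum f T N (T x))"
    using bound max_sum_nonneg[of f T N] by (intro integrable_const_bound[where B = "real N"]) auto
  have eqF: "(\<integral>x. max_sum f T N (T x) \<partial>M) = (\<integral>x. max_sum f T N x \<partial>M)"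
    using integral_distr[OF T, of "max_sum f T N"] inv by simp
  \<comment> \<open>\<open>h\<close> is \<open>f\<close> cut down to \<open>P\<close>, written with
    indicators so that its integral is a difference of probabilities.\<close>
  define h :: "'a \<Rightarrow> real" where "h x = indicator (B \<inter> P) x - l * indicator P x" for x
  have ih: "integrable M h" unfolding h_def
    by (intro Bochner_Integration.integrable_diff integrable_mult_right)
      (auto simp: emeasure_eq_measure less_top[symmetric])
  \<comment> \<open>On \<open>P\<close> this is \<open>max_sum_le\<close>; off \<open>P\<close> the
    left side and \<open>h\<close> vanish, and the remaining term is nonnegative.\<close>
  have "(\<integral>x. max_sum f T N x \<partial>M) \<le> (\<integral>x. h x + max_sum f T N (T x) \<partial>M)"
  proof (rule integral_mono)
    fix x assume "x \<in> space M"
    then show "max_sum f T N x \<le> h x + max_sum f T N (T x)"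
      using max_sum_le[of f T N x] max_sum_nonneg[of f T N x] max_sum_nonneg[of f T N "T x"]
      by (cases "x \<in> P") (auto simp: h_def P_def f_def indicator_def)
  qed (use iF iFT ih in auto)
  also have "\<dots> = (\<integral>x. h x \<partial>M) + (\<integral>x. max_sum f T N x \<partial>M)"
    using iFT ih eqF by simp
  finally have "0 \<le> (\<integral>x. h x \<partial>M)" by simp
  also have "\<dots> = prob (B \<inter> P) - l * prob P"
    unfolding h_def
    by (subst Bochner_Integration.integral_diff)
      (auto simp: emeasure_eq_measure less_top[symmetric] Int_absorb2 sets.sets_into_space[OF P] sets.sets_into_space[OF B] le_infI1)
  finally have "l * prob P \<le> prob (B \<inter> P)" by simp
  also have "\<dots> \<le> prob B" by (intro finite_measure_mono) auto
  finally show ?thesis by (simp add: P_def f_def[abs_def])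
qed

text \<open>For fixed \<open>l\<close>, the points at which level \<open>k\<close> fails form a set
  of probability at most \<open>prob (B k) / l\<close>, which tends to 0. So almost every point
  succeeds at some level, which depends on the point and on \<open>l\<close>.\<close>

lemma (in prob_space) AE_orbit_frequency_small:
  assumes T [measurable]: "T \<in> M \<rightarrow>\<^sub>M M" and inv: "distr M M T = M"
    and B: "\<And>k. B k \<in> sets M" and dec: "decseq B" and emp: "(\<Inter>k. B k) = {}"
  shows "AE x in M. \<forall>l>0. \<exists>k. \<forall>n. real (card {i. i < n \<and> (T ^^ i) x \<in> B k}) \<le> l * real n"
proof -
  note [measurable] = B
  have *: "AE x in M. \<exists>k. \<forall>n. real (card {i. i < n \<and> (T ^^ i) x \<in> B k}) \<le> l * real n"
    if l: "0 < l" for l :: real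
  proof -
    define f :: "nat \<Rightarrow> 'a \<Rightarrow> real" where "f k x = indicator (B k) x - l" for k x
    have f: "f k \<in> borel_measurable M" for k unfolding f_def by measurable
    define P where "P k N = {x \<in> space M. max_sum (f k) T N x > 0}" for k N
    have P [measurable]: "P k N \<in> sets M" for k N
      using max_sum_measurable[OF f T, of k N] unfolding P_def by measurable
    \<comment> \<open>\<open>Q k\<close> collects the points with a positive Birkhoff sum of
      \<open>f k\<close>, that is, with more than \<open>l * n\<close> visits to \<open>B k\<close>
      before some time \<open>n\<close>.\<close>
    define Q where "Q k = (\<Union>N. P k N)" for k
    have Q [measurable]: "Q k \<in> sets M" for k unfolding Q_def by measurable
    have Qle: "l * prob (Q k) \<le> prob (B k)" for k
    proof -
      have "incseq (P k)"
        unfolding P_def using max_sum_mono_Suc[of "f k" T]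
        by (intro incseq_SucI) (auto intro: order_less_le_trans)
      then have "(\<lambda>N. prob (P k N)) \<longlonglongrightarrow> prob (Q k)"
        unfolding Q_def by (intro finite_Lim_measure_incseq) auto
      then have "(\<lambda>N. l * prob (P k N)) \<longlonglongrightarrow> l * prob (Q k)" by (intro tendsto_intros)
      moreover have "l * prob (P k N) \<le> prob (B k)" for N
        using maximal_inequality_max_sum[OF T inv B l, of k N] by (simp add: P_def f_def[abs_def])
      ultimately show ?thesis by (intro LIMSEQ_le_const2) auto
    qed
    have "(\<lambda>k. prob (B k)) \<longlonglongrightarrow> prob (\<Inter>k. B k)"
      using dec B by (intro finite_Lim_measure_decseq) auto
    then have lim: "(\<lambda>k. prob (B k)) \<longlonglongrightarrow> 0" by (simp add: emp)
    have "l * prob (\<Inter>k. Q k) \<le> prob (B k)" for k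
    proof -
      have "prob (\<Inter>k. Q k) \<le> prob (Q k)" by (intro finite_measure_mono) auto
      with l have "l * prob (\<Inter>k. Q k) \<le> l * prob (Q k)" by simp
      with Qle[of k] show ?thesis by linarith
    qed
    with lim have "l * prob (\<Inter>k. Q k) \<le> 0" by (intro LIMSEQ_le_const) auto
    with l have "prob (\<Inter>k. Q k) = 0"
      by (metis measure_le_0_iff mult_le_cancel_left_pos mult_zero_right)
    then have "(\<Inter>k. Q k) \<in> null_sets M" by (auto simp: null_sets_def emeasure_eq_measure)
    then have "AE x in M. x \<notin> (\<Inter>k. Q k)" by (rule AE_not_in)
    then show ?thesis
    proof (rule AE_mp, intro AE_I2 impI)
      fix x assume x: "x \<in> space M" "x \<notin> (\<Inter>k. Q k)"
      then obtain k where k: "\<And>N. max_sum (f k) T N x \<le> 0"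
        by (force simp: Q_def P_def not_less)
      have "real (card {i. i < n \<and> (T ^^ i) x \<in> B k}) \<le> l * real n" for n
      proof -
        have "(\<Sum>i<n. f k ((T ^^ i) x)) \<le> 0"
          using sum_orbit_le_max_sum[of "f k" T x n] k[of n] by linarith
        moreover have "(\<Sum>i<n. f k ((T ^^ i) x)) = (\<Sum>i<n. indicator (B k) ((T ^^ i) x)) - l * real n"
          by (simp add: f_def sum_subtractf)
        moreover have "(\<Sum>i<n. indicator (B k) ((T ^^ i) x) :: real) =
            real (card {i. i < n \<and> (T ^^ i) x \<in> B k})"
        proof -
          have "(\<Sum>i<n. indicator (B k) ((T ^^ i) x) :: real) =
              (\<Sum>i\<in>{..<n}. if (T ^^ i) x \<in> B k then 1 else 0)"
            by (intro sum.cong) (auto simp: indicator_def)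
          also have "\<dots> = (\<Sum>i\<in>{i \<in> {..<n}. (T ^^ i) x \<in> B k}. 1)"
            by (rule sum.inter_filter[symmetric]) simp
          also have "\<dots> = real (card {i. i < n \<and> (T ^^ i) x \<in> B k})" by simp
          finally show ?thesis .
        qed
        ultimately show ?thesis by linarith
      qed
      then show "\<exists>k. \<forall>n. real (card {i. i < n \<and> (T ^^ i) x \<in> B k}) \<le> l * real n" by blast
    qed
  qed
  \<comment> \<open>Countably many values of \<open>l\<close> suffice, because the bound for a
    smaller \<open>l\<close> implies the one for a larger.\<close>
  have "AE x in M. \<forall>m::nat. \<exists>k. \<forall>n.
      real (card {i. i < n \<and> (T ^^ i) x \<in> B k}) \<le> inverse (real (Suc m)) * real n"
    by (subst AE_all_countable) (auto intro: *)
  then show ?thesis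
  proof (rule AE_mp, intro AE_I2 impI allI)
    fix x and l :: real
    assume x: "\<forall>m::nat. \<exists>k. \<forall>n.
      real (card {i. i < n \<and> (T ^^ i) x \<in> B k}) \<le> inverse (real (Suc m)) * real n" and l: "0 < l"
    from reals_Archimedean[OF l] obtain m where m: "inverse (real (Suc m)) < l" by auto
    from x obtain k where "\<And>n. real (card {i. i < n \<and> (T ^^ i) x \<in> B k}) \<le> inverse (real (Suc m)) * real n"
      by blast
    moreover have "inverse (real (Suc m)) * real n \<le> l * real n" for n
      using m by (intro mult_right_mono) auto
    ultimately show "\<exists>k. \<forall>n. real (card {i. i < n \<and> (T ^^ i) x \<in> B k}) \<le> l * real n"
      by (meson order_trans)
  qed
qed

section \<open>Orders of type \<int>\<close>

text \<open>The relational form of \<open>order_succ\<close>: its quantifier over a countable group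
  yields measurable events, and read backwards it describes predecessors.\<close>

definition covers :: "'a rel \<Rightarrow> 'a \<Rightarrow> 'a \<Rightarrow> bool" where
  "covers r a b \<longleftrightarrow> (a, b) \<in> r \<and> \<not> (\<exists>c. (a, c) \<in> r \<and> (c, b) \<in> r)"

lemma order_succ_covers: "order_succ r a = (THE b. covers r a b)"
  by (simp add: order_succ_def covers_def)

locale Z_order =
  fixes A :: "'a set" and r :: "'a rel"
  assumes type_Z: "type_Z_order_on A r"
begin

lemma carrier: "(a, b) \<in> r \<Longrightarrow> a \<in> A \<and> b \<in> A"
  using type_Z by (auto simp: type_Z_order_on_def)

lemma irrefl [simp]: "(a, a) \<notin> r"
  using type_Z by (auto simp: type_Z_order_on_def strict_linear_order_on_def irrefl_def)

lemma less_trans: "(a, b) \<in> r \<Longrightarrow> (b, c) \<in> r \<Longrightarrow> (a, c) \<in> r"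
  using type_Z by (auto simp: type_Z_order_on_def strict_linear_order_on_def dest: transD)

lemma asym: "(a, b) \<in> r \<Longrightarrow> (b, a) \<notin> r"
  using less_trans irrefl by blast

lemma linear: "a \<in> A \<Longrightarrow> b \<in> A \<Longrightarrow> a = b \<or> (a, b) \<in> r \<or> (b, a) \<in> r"
  using type_Z by (auto simp: type_Z_order_on_def strict_linear_order_on_def total_on_def)

lemma finite_order_interval: "finite (order_interval r a b)"
proof (cases "(a, b) \<in> r")
  case True
  with type_Z show ?thesis by (auto simp: type_Z_order_on_def)
next
  case False
  then have "order_interval r a b = {a, b}" using less_trans by (auto simp: order_interval_def)
  then show ?thesis by simp
qed

lemma converse: "Z_order A (r\<inverse>)"
proof
  have "order_interval (r\<inverse>) a b = order_interval r b a" for a b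
    by (auto simp: order_interval_def)
  with type_Z show "type_Z_order_on A (r\<inverse>)"
    unfolding type_Z_order_on_def strict_linear_order_on_def
    by (simp add: irrefl_def Ball_def) blast
qed

text \<open>Among the elements above \<open>a\<close>, take \<open>b\<close> with the smallest
  interval; a point strictly between would give a smaller one.\<close>

lemma ex_covers:
  assumes "a \<in> A"
  shows "\<exists>b. covers r a b"
proof -
  have "\<exists>b. (a, b) \<in> r" using type_Z assms by (auto simp: type_Z_order_on_def)
  then obtain b where b: "(a, b) \<in> r"
    and least: "\<And>c. (a, c) \<in> r \<Longrightarrow> card (order_interval r a b) \<le> card (order_interval r a c)"
    using ex_has_least_nat[of "\<lambda>b. (a, b) \<in> r" _ "\<lambda>b. card (order_interval r a b)"] by metis
  have "\<not> (\<exists>c. (a, c) \<in> r \<and> (c, b) \<in> r)"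
  proof
    assume "\<exists>c. (a, c) \<in> r \<and> (c, b) \<in> r"
    then obtain c where c: "(a, c) \<in> r" "(c, b) \<in> r" by auto
    have "order_interval r a c \<subseteq> order_interval r a b"
      using c less_trans by (auto simp: order_interval_def)
    moreover have "b \<in> order_interval r a b" "b \<notin> order_interval r a c"
      using b c asym irrefl by (auto simp: order_interval_def)
    ultimately have "order_interval r a c \<subset> order_interval r a b" by blast
    then have "card (order_interval r a c) < card (order_interval r a b)"
      by (rule psubset_card_mono[OF finite_order_interval])
    with least[OF c(1)] show False by simp
  qed
  with b show ?thesis by (auto simp: covers_def)
qed

lemma covers_unique: "covers r a b \<Longrightarrow> covers r a b' \<Longrightarrow> b = b'"
  unfolding covers_def using linear carrier by metis

lemma order_succ_eqI: "covers r a b \<Longrightarrow> order_succ r a = b"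
  unfolding order_succ_covers using covers_unique by blast

lemma covers_order_succ: "a \<in> A \<Longrightarrow> covers r a (order_succ r a)"
  using ex_covers order_succ_eqI by metis

lemma order_succ_in: "a \<in> A \<Longrightarrow> order_succ r a \<in> A"
  using covers_order_succ carrier by (auto simp: covers_def)

lemma funpow_order_succ_in: "a \<in> A \<Longrightarrow> (order_succ r ^^ n) a \<in> A"
  by (induction n) (auto intro: order_succ_in)

lemma covers_left_unique: "covers r a b \<Longrightarrow> covers r a' b \<Longrightarrow> a = a'"
  unfolding covers_def using linear carrier by metis

lemma ex_covers_left:
  assumes "b \<in> A"
  shows "\<exists>a. covers r a b"
  using Z_order.ex_covers[OF converse assms] by (auto simp: covers_def)

lemma funpow_order_succ_less:
  assumes a: "a \<in> A" and ij: "i < j"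
  shows "((order_succ r ^^ i) a, (order_succ r ^^ j) a) \<in> r"
  using ij
proof (induction j)
  case (Suc j)
  have "((order_succ r ^^ j) a, (order_succ r ^^ Suc j) a) \<in> r"
    using covers_order_succ[OF funpow_order_succ_in[OF a, of j]] by (simp add: covers_def)
  with Suc show ?case by (metis less_Suc_eq less_trans)
qed simp

lemma inj_funpow_order_succ:
  assumes "a \<in> A"
  shows "inj (\<lambda>i. (order_succ r ^^ i) a)"
  using funpow_order_succ_less[OF assms] irrefl by (intro injI) (metis linorder_neqE_nat)

text \<open>Passing to the next successor adds exactly one point, since an element below it is the
  previous end or lies below that end.\<close>

lemma order_interval_funpow_order_succ:
  assumes a: "a \<in> A"
  shows "order_interval r a ((order_succ r ^^ n) a) = (\<lambda>i. (order_succ r ^^ i) a) ` {..n}"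
proof (induction n)
  case 0
  show ?case using asym by (auto simp: order_interval_def)
next
  case (Suc n)
  let ?b = "(order_succ r ^^ n) a" and ?c = "(order_succ r ^^ Suc n) a"
  have cov: "covers r ?b ?c"
    using covers_order_succ[OF funpow_order_succ_in[OF a, of n]] by simp
  have ac: "(a, ?c) \<in> r" using funpow_order_succ_less[OF a, of 0 "Suc n"] by simp
  have ab: "?b = a \<or> (a, ?b) \<in> r" using funpow_order_succ_less[OF a, of 0 n] by (cases n) auto
  have iff: "(h, ?c) \<in> r \<longleftrightarrow> h = ?b \<or> (h, ?b) \<in> r" for h
    using cov linear[of h ?b] carrier less_trans unfolding covers_def by metis
  have "order_interval r a ?c = insert ?c (order_interval r a ?b)"
    using ab unfolding order_interval_def iff by (auto dest: less_trans)
  then show ?case by (simp add: Suc atMost_Suc)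
qed

end


section \<open>The successor map of a multiorder\<close>

text \<open>In an order of type Z, the part whose ends come in the wrong order is just the pair of
  ends, so the union is the interval between \<open>a\<close> and \<open>b\<close> whichever is
  smaller.\<close>

definition two_sided_interval :: "'a rel \<Rightarrow> 'a \<Rightarrow> 'a \<Rightarrow> 'a set" where
  "two_sided_interval r a b = order_interval r a b \<union> order_interval r b a"

locale group_multiorder = group G for G (structure) +
  fixes \<nu> :: "('a \<times> 'a \<Rightarrow> bool) measure"
  assumes countable_carrier: "countable (carrier G)"
    and multiorder: "multiorder G \<nu>"
begin

definition succ_map :: "('a \<times> 'a \<Rightarrow> bool) \<Rightarrow> ('a \<times> 'a \<Rightarrow> bool)" where
  "succ_map x = order_action G (order_succ (rel_of G x) \<one>) x"

sublocale prob_space \<nu>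
  using multiorder by (simp add: multiorder_def)

section \<open>Measurable events of a multiorder\<close>

lemma sets_multiorder: "sets \<nu> = sets (restrict_space (relation_borel G) (Z_orders G))"
  using multiorder by (simp add: multiorder_def)

lemma space_multiorder: "space \<nu> = Z_orders G"
proof -
  have "space \<nu> = space (restrict_space (relation_borel G) (Z_orders G))"
    using sets_multiorder by (rule sets_eq_imp_space_eq)
  then show ?thesis
    by (auto simp: space_restrict_space relation_borel_def space_measure_of_conv Z_orders_def)
qed

lemma action_measurable: "g \<in> carrier G \<Longrightarrow> order_action G g \<in> \<nu> \<rightarrow>\<^sub>M \<nu>"
  by (rule order_action_measurable[OF is_group _ sets_multiorder])

lemma action_invariant: "g \<in> carrier G \<Longrightarrow> distr \<nu> \<nu> (order_action G g) = \<nu>"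
  using multiorder by (simp add: multiorder_def)

lemma action_in: "g \<in> carrier G \<Longrightarrow> x \<in> space \<nu> \<Longrightarrow> order_action G g x \<in> space \<nu>"
  using order_action_Z_orders[OF is_group] by (simp add: space_multiorder)

lemma Z_order_rel_of: "x \<in> space \<nu> \<Longrightarrow> Z_order (carrier G) (rel_of G x)"
  by unfold_locales (simp add: space_multiorder Z_orders_def)

text \<open>Coordinate projections are continuous, so this is the trace of an open set. The later
  events are countable combinations of such events.\<close>

lemma rel_of_sets: "{x \<in> space \<nu>. (a, b) \<in> rel_of G x} \<in> sets \<nu>"
proof (cases "a \<in> carrier G \<and> b \<in> carrier G")
  case True
  let ?T = "relation_topology G"
  have "continuous_map ?T (discrete_topology (UNIV :: bool set)) (\<lambda>x. x (a, b))"
    unfolding relation_topology_def using True by (intro continuous_map_product_projection) auto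
  then have "openin ?T {x \<in> topspace ?T. x (a, b) \<in> {True}}"
    by (rule openin_continuous_map_preimage) simp
  then have "{x \<in> topspace ?T. x (a, b)} \<in> sets (relation_borel G)"
    by (auto simp: relation_borel_def sets_measure_of_conv dest: openin_subset)
  then have "Z_orders G \<inter> {x \<in> topspace ?T. x (a, b)} \<in> sets \<nu>"
    by (auto simp: sets_multiorder sets_restrict_space)
  also have "Z_orders G \<inter> {x \<in> topspace ?T. x (a, b)} = {x \<in> space \<nu>. (a, b) \<in> rel_of G x}"
    using True by (auto simp: space_multiorder Z_orders_def rel_of_def)
  finally show ?thesis .
qed (auto simp: rel_of_def)

lemma covers_sets: "{x \<in> space \<nu>. covers (rel_of G x) a b} \<in> sets \<nu>"
proof -
  have "{x \<in> space \<nu>. covers (rel_of G x) a b} = {x \<in> space \<nu>. (a, b) \<in> rel_of G x \<and>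
      \<not> (\<exists>c\<in>carrier G. (a, c) \<in> rel_of G x \<and> (c, b) \<in> rel_of G x)}"
    by (auto simp: covers_def rel_of_def)
  also have "\<dots> \<in> sets \<nu>"
    by (intro sets.sets_Collect_conj sets.sets_Collect_neg sets.sets_Collect_countable_Ex'
        rel_of_sets countable_carrier)
  finally show ?thesis .
qed

lemma not_two_sided_interval_subset_sets:
  "{x \<in> space \<nu>. \<not> two_sided_interval (rel_of G x) a b \<subseteq> C} \<in> sets \<nu>"
proof -
  have "{x \<in> space \<nu>. \<not> two_sided_interval (rel_of G x) a b \<subseteq> C} = {x \<in> space \<nu>. \<not> {a, b} \<subseteq> C \<or>
      (\<exists>c\<in>carrier G - C. ((a, c) \<in> rel_of G x \<and> (c, b) \<in> rel_of G x) \<or>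
        ((b, c) \<in> rel_of G x \<and> (c, a) \<in> rel_of G x))}"
    by (auto simp: two_sided_interval_def order_interval_def rel_of_def)
  also have "\<dots> \<in> sets \<nu>"
    by (intro sets.sets_Collect_conj sets.sets_Collect_disj sets.sets_Collect_countable_Ex'
        rel_of_sets countable_carrier countable_Diff sets.sets_Collect_const)
  finally show ?thesis .
qed

section \<open>Transport of order notions by the action\<close>

lemma order_action_mult:
  assumes "g \<in> carrier G" "h \<in> carrier G"
  shows "order_action G g (order_action G h x) = order_action G (g \<otimes> h) x"
  using assms by (auto simp: order_action_def m_assoc fun_eq_iff)

lemma order_action_one: "x \<in> space \<nu> \<Longrightarrow> order_action G \<one> x = x"
  by (auto simp: order_action_def space_multiorder Z_orders_def topspace_relation_topology
      PiE_def extensional_def fun_eq_iff)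

text \<open>Right multiplication by \<open>g\<close> is an isomorphism from the moved order onto the
  original one.\<close>

lemma covers_order_action:
  assumes g: "g \<in> carrier G" and ab: "a \<in> carrier G" "b \<in> carrier G"
  shows "covers (rel_of G (order_action G g x)) a b \<longleftrightarrow> covers (rel_of G x) (a \<otimes> g) (b \<otimes> g)"
proof -
  have "\<exists>d\<in>carrier G. c = d \<otimes> g" if "c \<in> carrier G" for c
    using that g by (intro bexI[of _ "c \<otimes> inv g"]) (auto simp: m_assoc)
  moreover have "c \<in> carrier G" if "(c, d) \<in> rel_of G x" for c d
    using that by (auto simp: rel_of_def)
  ultimately show ?thesis
    unfolding covers_def rel_of_order_action[OF is_group g] using ab by metis
qed

text \<open>The interval itself is translated by \<open>g\<close>, so only its size is kept. This
  turns distance from the unit in a moved order into distance along the orbit in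
  \<open>x\<close>.\<close>

lemma card_two_sided_interval_order_action:
  assumes g: "g \<in> carrier G" and ab: "a \<in> carrier G" "b \<in> carrier G"
  shows "card (two_sided_interval (rel_of G (order_action G g x)) a b) =
    card (two_sided_interval (rel_of G x) (a \<otimes> g) (b \<otimes> g))"
proof -
  let ?B = "two_sided_interval (rel_of G (order_action G g x)) a b"
  have sub: "?B \<subseteq> carrier G" using ab by (auto simp: two_sided_interval_def order_interval_def rel_of_def)
  have ex: "\<exists>d\<in>carrier G. c = d \<otimes> g" if "c \<in> carrier G" for c
    using that g by (intro bexI[of _ "c \<otimes> inv g"]) (auto simp: m_assoc)
  have iff: "c \<in> ?B \<longleftrightarrow> c \<otimes> g \<in> two_sided_interval (rel_of G x) (a \<otimes> g) (b \<otimes> g)" if "c \<in> carrier G" for c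
    using that g ab
    by (simp add: two_sided_interval_def order_interval_def rel_of_order_action[OF is_group g])
  have "two_sided_interval (rel_of G x) (a \<otimes> g) (b \<otimes> g) \<subseteq> carrier G"
    using ab g by (auto simp: two_sided_interval_def order_interval_def rel_of_def)
  then have "two_sided_interval (rel_of G x) (a \<otimes> g) (b \<otimes> g) = (\<lambda>c. c \<otimes> g) ` ?B"
    using ex iff sub by (auto simp: image_iff) (metis subsetD)
  moreover have "inj_on (\<lambda>c. c \<otimes> g) ?B"
    using sub g by (intro inj_onI) (metis right_cancel subsetD)
  ultimately show ?thesis by (simp add: card_image)
qed

section \<open>The successor map preserves the measure\<close>

lemma order_succ_in_carrier:
  assumes "x \<in> space \<nu>" "a \<in> carrier G"
  shows "order_succ (rel_of G x) a \<in> carrier G"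
  using Z_order.order_succ_in[OF Z_order_rel_of] assms by blast

text \<open>Cutting by the value of the successor of the unit replaces \<open>succ_map\<close> by
  single group actions on countably many pieces; both measurability and invariance use this.\<close>

lemma succ_map_vimage:
  "succ_map -` S \<inter> space \<nu> = (\<Union>g\<in>carrier G.
    {x \<in> space \<nu>. covers (rel_of G x) \<one> g} \<inter> (order_action G g -` S \<inter> space \<nu>))"
proof -
  have "covers (rel_of G x) \<one> (order_succ (rel_of G x) \<one>)" if "x \<in> space \<nu>" for x
    using Z_order.covers_order_succ[OF Z_order_rel_of[OF that]] by simp
  moreover have "order_succ (rel_of G x) \<one> = g"
    if "x \<in> space \<nu>" "covers (rel_of G x) \<one> g" for x g
    using Z_order.order_succ_eqI[OF Z_order_rel_of] that by blast
  ultimately show ?thesis by (auto simp: succ_map_def intro!: bexI order_succ_in_carrier[OF _ one_closed])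
qed

lemma succ_map_measurable: "succ_map \<in> \<nu> \<rightarrow>\<^sub>M \<nu>"
proof (rule measurableI)
  show "succ_map x \<in> space \<nu>" if "x \<in> space \<nu>" for x
    unfolding succ_map_def using that order_succ_in_carrier by (intro action_in) auto
  show "succ_map -` S \<inter> space \<nu> \<in> sets \<nu>" if "S \<in> sets \<nu>" for S
    unfolding succ_map_vimage using that
    by (intro sets.countable_UN'' countable_carrier sets.Int covers_sets
        measurable_sets[OF action_measurable])
qed

text \<open>
  On the event that \<open>g\<close> is the successor of the unit, \<open>succ_map\<close> is the action of \<open>g\<close>; the images
  of these events are the events that the predecessor of the unit is \<open>inv g\<close>, and they partition
  the space.
\<close>

lemma succ_map_invariant: "distr \<nu> \<nu> succ_map = \<nu>"
proof (rule measure_eqI)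
  fix S assume "S \<in> sets (distr \<nu> \<nu> succ_map)"
  then have S: "S \<in> sets \<nu>" by simp
  define E where "E g = {x \<in> space \<nu>. covers (rel_of G x) \<one> g}" for g
  define P where "P g = {x \<in> space \<nu>. covers (rel_of G x) (inv g) \<one>}" for g
  have E: "E g \<in> sets \<nu>" and P: "P g \<in> sets \<nu>" for g
    unfolding E_def P_def by (rule covers_sets)+
  \<comment> \<open>Right multiplication by \<open>g\<close> carries \<open>inv g\<close> and the
    unit to the unit and \<open>g\<close>, so \<open>g\<close> covers the unit in \<open>x\<close>
    exactly if the unit covers \<open>inv g\<close> in the moved order.\<close>
  have EP: "E g \<inter> (order_action G g -` S \<inter> space \<nu>) = order_action G g -` (P g \<inter> S) \<inter> space \<nu>"
    if g: "g \<in> carrier G" for g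
    using covers_order_action[OF g, of "inv g" \<one>] action_in[OF g] g
    by (auto simp: E_def P_def)
  have inv: "emeasure \<nu> (order_action G g -` D \<inter> space \<nu>) = emeasure \<nu> D"
    if "g \<in> carrier G" "D \<in> sets \<nu>" for g D
    using emeasure_distr[OF action_measurable[OF that(1)] that(2)] action_invariant[OF that(1)]
    by simp
  have disjE: "disjoint_family_on E (carrier G)"
    unfolding disjoint_family_on_def E_def
    using Z_order.covers_unique[OF Z_order_rel_of] by blast
  have disjP: "disjoint_family_on P (carrier G)"
  proof (unfold disjoint_family_on_def, intro ballI impI)
    fix g h assume gh: "g \<in> carrier G" "h \<in> carrier G" "g \<noteq> h"
    have "inv g = inv h" if "x \<in> P g \<inter> P h" for x
      using that Z_order.covers_left_unique[OF Z_order_rel_of] unfolding P_def by blast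
    with gh show "P g \<inter> P h = {}" by (metis inv_inv disjoint_iff IntI)
  qed
  have UP: "(\<Union>g\<in>carrier G. P g \<inter> S) = S"
  proof (intro equalityI subsetI)
    fix x assume x: "x \<in> S"
    then have xs: "x \<in> space \<nu>" using sets.sets_into_space[OF S] by auto
    then obtain a where a: "covers (rel_of G x) a \<one>"
      using Z_order.ex_covers_left[OF Z_order_rel_of] by blast
    then have "a \<in> carrier G" by (auto simp: covers_def rel_of_def)
    with a xs x show "x \<in> (\<Union>g\<in>carrier G. P g \<inter> S)"
      by (auto simp: P_def intro!: bexI[of _ "inv a"])
  qed auto
  have "emeasure (distr \<nu> \<nu> succ_map) S = emeasure \<nu> (succ_map -` S \<inter> space \<nu>)"
    by (rule emeasure_distr[OF succ_map_measurable S])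
  also have "\<dots> = emeasure \<nu> (\<Union>g\<in>carrier G. E g \<inter> (order_action G g -` S \<inter> space \<nu>))"
    by (simp only: succ_map_vimage E_def)
  \<comment> \<open>The countable sum over the group is written as an integral over counting
    measure.\<close>
  also have "\<dots> = (\<integral>\<^sup>+g. emeasure \<nu> (E g \<inter> (order_action G g -` S \<inter> space \<nu>)) \<partial>count_space (carrier G))"
    using disjE by (intro emeasure_UN_countable countable_carrier sets.Int E
        measurable_sets[OF action_measurable] S) (auto simp: disjoint_family_on_def)
  also have "\<dots> = (\<integral>\<^sup>+g. emeasure \<nu> (P g \<inter> S) \<partial>count_space (carrier G))"
    by (intro nn_integral_cong) (simp only: EP inv space_count_space sets.Int[OF P S])
  also have "\<dots> = emeasure \<nu> (\<Union>g\<in>carrier G. P g \<inter> S)"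
    using disjP by (intro emeasure_UN_countable[symmetric] countable_carrier sets.Int P S)
      (auto simp: disjoint_family_on_def)
  finally show "emeasure (distr \<nu> \<nu> succ_map) S = emeasure \<nu> S" by (simp only: UP)
qed simp

text \<open>In the order moved by \<open>?a\<close>, the successor of the unit is
  \<open>?b \<otimes> inv ?a\<close>, since right multiplication by \<open>?a\<close> carries it to
  \<open>?b\<close>. Composing the two actions leaves that of \<open>?b\<close>.\<close>

lemma funpow_succ_map:
  assumes x: "x \<in> space \<nu>"
  shows "(succ_map ^^ n) x = order_action G ((order_succ (rel_of G x) ^^ n) \<one>) x"
proof (induction n)
  case 0
  show ?case by (simp add: order_action_one x)
next
  case (Suc n)
  interpret Z_order "carrier G" "rel_of G x" by (rule Z_order_rel_of[OF x])
  let ?a = "(order_succ (rel_of G x) ^^ n) \<one>"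
  have a: "?a \<in> carrier G" by (intro funpow_order_succ_in) simp
  let ?b = "order_succ (rel_of G x) ?a" and ?y = "order_action G ?a x"
  have b: "?b \<in> carrier G" by (intro order_succ_in a)
  have "covers (rel_of G x) (\<one> \<otimes> ?a) ((?b \<otimes> inv ?a) \<otimes> ?a)"
    using covers_order_succ[OF a] a b by (simp add: m_assoc)
  then have "covers (rel_of G ?y) \<one> (?b \<otimes> inv ?a)"
    using a b by (subst covers_order_action) auto
  then have "order_succ (rel_of G ?y) \<one> = ?b \<otimes> inv ?a"
    by (rule Z_order.order_succ_eqI[OF Z_order_rel_of[OF action_in[OF a x]]])
  then have "succ_map ?y = order_action G ?b x"
    using a b by (simp add: succ_map_def order_action_mult m_assoc)
  with Suc show ?case by simp
qed

section \<open>Counting the points of an interval moved out of it\<close>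

text \<open>
  Nearness to the unit is measured by a fixed enumeration of \<open>G\<close> instead of by cardinality: this is
  stronger, and its measurability is immediate.
\<close>

definition far_set :: "'a \<Rightarrow> nat \<Rightarrow> ('a \<times> 'a \<Rightarrow> bool) set" where
  "far_set g k =
    {x \<in> space \<nu>. \<not> two_sided_interval (rel_of G x) \<one> g \<subseteq> from_nat_into (carrier G) ` {..<k}}"

lemma decseq_far_set: "decseq (far_set g)"
  unfolding far_set_def by (intro decseq_SucI) fastforce

text \<open>The interval between the unit and \<open>g\<close> is finite, so the indices of its
  points in the enumeration are bounded.\<close>

lemma INT_far_set:
  assumes g: "g \<in> carrier G"
  shows "(\<Inter>k. far_set g k) = {}"
proof -
  have "\<exists>k. x \<notin> far_set g k" if x: "x \<in> space \<nu>" for x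
  proof -
    let ?B = "two_sided_interval (rel_of G x) \<one> g"
    have "finite ?B"
      using Z_order.finite_order_interval[OF Z_order_rel_of[OF x]] by (simp add: two_sided_interval_def)
    then have "finite (to_nat_on (carrier G) ` ?B)" by simp
    then obtain k where k: "to_nat_on (carrier G) ` ?B \<subseteq> {..<k}"
      by (meson finite_nat_iff_bounded)
    have "?B \<subseteq> carrier G" using g by (auto simp: two_sided_interval_def order_interval_def rel_of_def)
    then have "?B \<subseteq> from_nat_into (carrier G) ` {..<k}"
      using k countable_carrier
      by (auto intro!: image_eqI[where x = "to_nat_on (carrier G) _"]
          simp: from_nat_into_to_nat_on image_subset_iff subset_iff)
    then show ?thesis by (auto simp: far_set_def)
  qed
  then show ?thesis by (auto simp: far_set_def)
qed

lemma card_orbit_diff_le: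
  assumes x: "x \<in> space \<nu>" and g: "g \<in> carrier G"
  defines "a \<equiv> \<lambda>i. (order_succ (rel_of G x) ^^ i) \<one>"
  shows "card {i. i \<le> n \<and> g \<otimes> a i \<notin> a ` {..n}} \<le>
    2 * k + card {i. i < Suc n \<and> (succ_map ^^ i) x \<in> far_set g k}"
proof -
  interpret Z_order "carrier G" "rel_of G x" by (rule Z_order_rel_of[OF x])
  let ?r = "rel_of G x"
  have a: "a i \<in> carrier G" for i unfolding a_def by (intro funpow_order_succ_in) simp
  have inj: "inj a" unfolding a_def by (intro inj_funpow_order_succ) simp
  have less: "(a i, a j) \<in> ?r" if "i < j" for i j
    unfolding a_def using that by (intro funpow_order_succ_less) simp
  have int: "order_interval ?r (a 0) (a n) = a ` {..n}"
    using order_interval_funpow_order_succ[of \<one> n] by (simp add: a_def)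
  \<comment> \<open>If \<open>g \<otimes> a i\<close> lies below \<open>a 0\<close>, then
    \<open>a 0\<close>, ..., \<open>a i\<close> all lie between it and \<open>a i\<close>; if it
    lies above \<open>a n\<close>, the same holds for \<open>a i\<close>, ..., \<open>a n\<close>.
    Such an interval has at most \<open>k\<close> points.\<close>
  have close: "i < k \<or> n - i < k"
    if i: "i \<le> n" and out: "g \<otimes> a i \<notin> a ` {..n}" and nf: "(succ_map ^^ i) x \<notin> far_set g k" for i
  proof -
    let ?h = "g \<otimes> a i" and ?y = "order_action G (a i) x"
    have h: "?h \<in> carrier G" using g a by simp
    have fin: "finite (two_sided_interval ?r (a i) ?h)"
      using finite_order_interval by (simp add: two_sided_interval_def)
    have "?y \<notin> far_set g k" using nf funpow_succ_map[OF x, of i] by (simp add: a_def)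
    then have "two_sided_interval (rel_of G ?y) \<one> g \<subseteq> from_nat_into (carrier G) ` {..<k}"
      using action_in[OF a x] by (auto simp: far_set_def)
    then have "card (two_sided_interval (rel_of G ?y) \<one> g) \<le> card {..<k}"
      by (meson card_image_le card_mono finite_imageI finite_lessThan order_trans)
    then have card: "card (two_sided_interval ?r (a i) ?h) \<le> k"
      using card_two_sided_interval_order_action[OF a _ g, of \<one> i x] a by simp
    have many: "card J \<le> k" if "a ` J \<subseteq> two_sided_interval ?r (a i) ?h" for J
      using card_mono[OF fin that] card card_image[OF inj_on_subset[OF inj subset_UNIV], of J] by simp
    have "(?h, a 0) \<in> ?r \<or> (a n, ?h) \<in> ?r"
      using out linear[OF h a[of 0]] linear[OF h a[of n]] unfolding int[symmetric] order_interval_def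
      by auto
    then show ?thesis
    proof
      assume *: "(?h, a 0) \<in> ?r"
      have "a j \<in> two_sided_interval ?r (a i) ?h" if "j \<le> i" for j
        using * less[of 0 j] less[of j i] less_trans[of ?h "a 0" "a j"] that
        by (cases "j = 0"; cases "j = i") (auto simp: two_sided_interval_def order_interval_def)
      \<comment> \<open>The set has \<open>i + 1\<close> elements, whence the strict bound
        \<open>i < k\<close>.\<close>
      then have "card {..i} \<le> k" by (intro many) auto
      then show ?thesis by simp
    next
      assume *: "(a n, ?h) \<in> ?r"
      have "a j \<in> two_sided_interval ?r (a i) ?h" if "i \<le> j" "j \<le> n" for j
        using * less[of i j] less[of j n] less_trans[of "a j" "a n" ?h] that
        by (cases "j = n"; cases "j = i") (auto simp: two_sided_interval_def order_interval_def)
      then have "card {i..n} \<le> k" by (intro many) auto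
      with i have "n - i < k" by (simp add: Suc_diff_le)
      then show ?thesis ..
    qed
  qed
  let ?Far = "{i. i < Suc n \<and> (succ_map ^^ i) x \<in> far_set g k}"
  have "{i. i \<le> n \<and> g \<otimes> a i \<notin> a ` {..n}} \<subseteq> {..<k} \<union> (\<lambda>j. n - j) ` {..<k} \<union> ?Far"
  proof
    fix i assume i: "i \<in> {i. i \<le> n \<and> g \<otimes> a i \<notin> a ` {..n}}"
    then consider "i < k" | "n - i < k" | "i \<in> ?Far" using close[of i] by auto
    then show "i \<in> {..<k} \<union> (\<lambda>j. n - j) ` {..<k} \<union> ?Far"
    proof cases
      case 2
      \<comment> \<open>Subtraction is truncated, so \<open>i \<le> n\<close> matters here.\<close>
      moreover have "i = n - (n - i)" using i by simp
      ultimately have "i \<in> (\<lambda>j. n - j) ` {..<k}" by blast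
      then show ?thesis by simp
    qed auto
  qed
  then have "card {i. i \<le> n \<and> g \<otimes> a i \<notin> a ` {..n}} \<le> card ({..<k} \<union> (\<lambda>j. n - j) ` {..<k} \<union> ?Far)"
    by (intro card_mono) auto
  also have "\<dots> \<le> card {..<k} + card ((\<lambda>j. n - j) ` {..<k}) + card ?Far"
    by (meson card_Un_le add_mono order_refl order_trans)
  also have "\<dots> \<le> 2 * k + card ?Far"
    using card_image_le[of "{..<k}" "\<lambda>j. n - j"] by simp
  finally show ?thesis .
qed

text \<open>Each index whose point stays inside yields its own element of
  \<open>F n \<inter> (g <# F n)\<close>, so the defect is at most the number of bad indices: a
  constant from the two ends plus a small multiple of \<open>n + 1\<close>.\<close>

lemma order_interval_ratio_tendsto:
  assumes x: "x \<in> space \<nu>" and g: "g \<in> carrier G"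
    and rare: "\<forall>l>0. \<exists>k. \<forall>n.
      real (card {i. i < n \<and> (succ_map ^^ i) x \<in> far_set g k}) \<le> l * real n"
  defines "F \<equiv> \<lambda>n. order_interval (rel_of G x) \<one> ((order_succ (rel_of G x) ^^ n) \<one>)"
  shows "(\<lambda>n. real (card (F n \<inter> (g <# F n))) / real (card (F n))) \<longlonglongrightarrow> 1"
proof -
  interpret Z_order "carrier G" "rel_of G x" by (rule Z_order_rel_of[OF x])
  define a where "a = (\<lambda>i. (order_succ (rel_of G x) ^^ i) \<one>)"
  have a: "a i \<in> carrier G" for i unfolding a_def by (intro funpow_order_succ_in) simp
  have inj: "inj a" unfolding a_def by (intro inj_funpow_order_succ) simp
  have F: "F n = a ` {..n}" for n
    unfolding F_def a_def by (intro order_interval_funpow_order_succ) simp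
  have cF: "card (F n) = Suc n" for n
    unfolding F using card_image[OF inj_on_subset[OF inj subset_UNIV], of "{..n}"] by simp
  define bad where "bad n = {i. i \<le> n \<and> g \<otimes> a i \<notin> a ` {..n}}" for n
  have bad: "bad n \<subseteq> {..n}" for n unfolding bad_def by blast
  have lower: "Suc n \<le> card (F n \<inter> (g <# F n)) + card (bad n)" for n
  proof -
    have "(\<lambda>i. g \<otimes> a i) ` ({..n} - bad n) \<subseteq> F n \<inter> (g <# F n)"
      unfolding F l_coset_def bad_def by blast
    moreover have "finite (F n \<inter> (g <# F n))" by (simp add: F)
    moreover have "inj_on (\<lambda>i. g \<otimes> a i) ({..n} - bad n)"
      using g a inj by (intro inj_onI) (auto dest: injD)
    ultimately have "card ({..n} - bad n) \<le> card (F n \<inter> (g <# F n))"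
      by (metis card_image card_mono)
    moreover have "card ({..n} - bad n) = Suc n - card (bad n)"
      using card_Diff_subset[OF finite_subset[OF bad finite_atMost] bad] by simp
    ultimately show ?thesis by linarith
  qed
  show ?thesis
  proof (rule LIMSEQ_I)
    fix e :: real assume e: "0 < e"
    then have "0 < e / 2" by simp
    \<comment> \<open>Half of \<open>e\<close> pays for the visits to \<open>far_set g k\<close>,
      the other half for the \<open>2 * k\<close> indices near the ends.\<close>
    with rare obtain k where k: "\<And>n. real (card {i. i < n \<and> (succ_map ^^ i) x \<in> far_set g k}) \<le> e / 2 * real n"
      by blast
    \<comment> \<open>This bound makes \<open>2 * k\<close> smaller than
      \<open>e / 2 * (n + 1)\<close> for \<open>n \<ge> n0\<close>.\<close>
    obtain n0 :: nat where n0: "4 * real k / e < real n0" using reals_Archimedean2 by blast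
    have "norm (real (card (F n \<inter> (g <# F n))) / real (card (F n)) - 1) < e" if n: "n0 \<le> n" for n
    proof -
      let ?c = "real (card (F n \<inter> (g <# F n)))"
      have up: "?c \<le> real (Suc n)"
        using card_mono[of "F n" "F n \<inter> (g <# F n)"] unfolding cF by (simp add: F)
      have "real (card (bad n)) \<le> real (2 * k + card {i. i < Suc n \<and> (succ_map ^^ i) x \<in> far_set g k})"
        unfolding of_nat_le_iff bad_def a_def by (rule card_orbit_diff_le[OF x g])
      with k[of "Suc n"] have "real (card (bad n)) \<le> 2 * real k + e / 2 * real (Suc n)"
        by simp
      moreover have "2 * real k < e / 2 * real (Suc n)"
      proof -
        have "4 * real k < e * real n0" using n0 e by (simp add: field_simps)
        also have "\<dots> \<le> e * real (Suc n)" using n e by (intro mult_left_mono) auto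
        finally show ?thesis by simp
      qed
      moreover have "real (Suc n) \<le> ?c + real (card (bad n))"
        using lower[of n] by (metis of_nat_add of_nat_le_iff)
      ultimately have "real (Suc n) - ?c < e * real (Suc n)" by linarith
      moreover have "norm (?c / real (card (F n)) - 1) = (real (Suc n) - ?c) / real (Suc n)"
      proof -
        have "?c / real (Suc n) - 1 = - ((real (Suc n) - ?c) / real (Suc n))"
          by (simp add: diff_divide_distrib)
        moreover have "0 \<le> (real (Suc n) - ?c) / real (Suc n)" using up by simp
        ultimately show ?thesis unfolding cF real_norm_def by linarith
      qed
      ultimately show ?thesis by (simp add: pos_divide_less_eq)
    qed
    then show "\<exists>n0. \<forall>n\<ge>n0. norm (real (card (F n \<inter> (g <# F n))) / real (card (F n)) - 1) < e" by blast
  qed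
qed

section \<open>Folner property and amenability\<close>

lemma Folner_property: "Folner_property G \<nu>"
proof -
  have "far_set g k \<in> sets \<nu>" for g k
    unfolding far_set_def by (rule not_two_sided_interval_subset_sets)
  then have "AE x in \<nu>. \<forall>g\<in>carrier G. \<forall>l>0. \<exists>k. \<forall>n.
      real (card {i. i < n \<and> (succ_map ^^ i) x \<in> far_set g k}) \<le> l * real n"
    \<comment> \<open>Countability of the group gives one null set that serves every
      \<open>g\<close>.\<close>
    by (subst AE_ball_countable[OF countable_carrier], intro ballI
        AE_orbit_frequency_small[OF succ_map_measurable succ_map_invariant])
      (simp_all add: decseq_far_set INT_far_set)
  then show ?thesis
    unfolding Folner_property_def
  proof (rule AE_mp, intro AE_I2 impI)
    fix x assume x: "x \<in> space \<nu>" and rare: "\<forall>g\<in>carrier G. \<forall>l>0. \<exists>k. \<forall>n.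
      real (card {i. i < n \<and> (succ_map ^^ i) x \<in> far_set g k}) \<le> l * real n"
    interpret Z_order "carrier G" "rel_of G x" by (rule Z_order_rel_of[OF x])
    show "Folner_sequence G
        (\<lambda>n. order_interval (rel_of G x) \<one> ((order_succ (rel_of G x) ^^ n) \<one>))"
      unfolding Folner_sequence_def
      using order_interval_ratio_tendsto[OF x] rare funpow_order_succ_in[OF one_closed]
      by (auto simp: order_interval_funpow_order_succ)
  qed
qed

text \<open>An almost sure property in a probability space holds at some point, and the intervals of
  one such order are a Folner sequence.\<close>

lemma amenable: "amenable G"
  using eventually_happens'[OF ae_filter_bot Folner_property[unfolded Folner_property_def]]
  unfolding amenable_def by blast

end

theorem theorem2p5:
  fixes G :: "('a, 'm) monoid_scheme"
    and \<nu> :: "('a \<times> 'a \<Rightarrow> bool) measure"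
  assumes "group G"
    and "countable (carrier G)"
    and "infinite (carrier G)"
    and "multiorder G \<nu>"
  shows "Folner_property G \<nu> \<and> amenable G"
proof -
  interpret group_multiorder G \<nu>
    using assms by (simp add: group_multiorder_def group_multiorder_axioms_def)
  show ?thesis using Folner_property amenable by simp
qed

end
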